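(* Let $N\ge1$, let $F:\mathscr{P}(N,\mathbb{C})\to\mathbb{R}$ be strictly convex and differentiable, let $\delta_F$ be the corresponding total Bregman divergence, and let $\bm{X}_1,\dots,\bm{X}_m\in\mathscr{P}(N,\mathbb{C})$, $m\ge1$. If the TBD mean $$\overline{\bm{X}}=\underset{\bm{X}\in\mathscr{P}(N,\mathbb{C})}{\operatorname{argmin}}\ \frac1m\sum_{i=1}^m\delta_F(\bm{X},\bm{X}_i)$$ exists, then $\bm{X}=\overline{\bm{X}}$ solves the equation $$\nabla F(\bm{X})=\left(\sum_{i=1}^m\frac{\nabla F(\bm{X}_i)}{\sqrt{1+\|\nabla F(\bm{X}_i)\|^2}}\right)\Big/\left(\sum_{j=1}^m\frac{1}{\sqrt{1+\|\nabla F(\bm{X}_j)\|^2}}\right).$$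
   Context: $\mathscr{P}(N,\mathbb{C})$ is the set of $N\times N$ complex Hermitian positive-definite (HPD) matrices, an open convex subset of the real vector space of Hermitian matrices. The Frobenius inner product is $\langle\bm{X},\bm{Y}\rangle=\operatorname{tr}(\bm{X}^{\mathrm H}\bm{Y})$ (real on Hermitian matrices) and $\|\bm{X}\|=\sqrt{\langle\bm{X},\bm{X}\rangle}$. The gradient $\nabla F(\bm{X})$ is the Hermitian matrix determined by $\langle\nabla F(\bm{X}),\bm{V}\rangle=\frac{d}{d\varepsilon}\big|_{\varepsilon=0}F(\bm{X}+\varepsilon\bm{V})$ for all Hermitian $\bm{V}$. The total Bregman divergence (TBD) associated with $F$ is $$\delta_F(\bm{X},\bm{Y})=\frac{F(\bm{X})-F(\bm{Y})-\langle \nabla F(\bm{Y}),\bm{X}-\bm{Y}\rangle}{\sqrt{1+\|\nabla F(\bm{Y})\|^2}}.$$ *)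

theory Defs
  imports "HOL-Analysis.Analysis"
begin

definition conj_transpose :: "complex^'n^'m \<Rightarrow> complex^'m^'n" where
  "conj_transpose A = (\<chi> i j. cnj (A $ j $ i))"

definition hermitian :: "complex^'n^'n \<Rightarrow> bool" where
  "hermitian A \<longleftrightarrow> conj_transpose A = A"

(* For Hermitian A the form is real-valued, so taking Re discards nothing. *)
definition HPD :: "(complex^'n^'n) set" where
  "HPD = {A. hermitian A \<and> (\<forall>x. x \<noteq> 0 \<longrightarrow> Re (\<Sum>i\<in>UNIV. cnj (x $ i) * (A *v x) $ i) > 0)}"

(* The trace is real when X and Y are Hermitian: see of_real_frob_inner. *)
definition frob_inner :: "complex^'n^'n \<Rightarrow> complex^'n^'n \<Rightarrow> real" where
  "frob_inner X Y = Re (trace (conj_transpose X ** Y))"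

definition frob_norm :: "complex^'n^'n \<Rightarrow> real" where
  "frob_norm X = sqrt (frob_inner X X)"

definition strictly_convex_on :: "'a::real_vector set \<Rightarrow> ('a \<Rightarrow> real) \<Rightarrow> bool" where
  "strictly_convex_on S f \<longleftrightarrow> convex S \<and>
     (\<forall>x\<in>S. \<forall>y\<in>S. \<forall>t. x \<noteq> y \<longrightarrow> 0 < t \<longrightarrow> t < 1 \<longrightarrow>
        f ((1 - t) *\<^sub>R x + t *\<^sub>R y) < (1 - t) * f x + t * f y)"

(* Only Hermitian directions V occur. HPD is open in the space of Hermitian matrices, so for X in
   HPD the values of F outside HPD are irrelevant. *)
definition has_gradient :: "(complex^'n^'n \<Rightarrow> real) \<Rightarrow> complex^'n^'n \<Rightarrow> complex^'n^'n \<Rightarrow> bool" where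
  "has_gradient F X G \<longleftrightarrow> hermitian G \<and>
     (\<forall>V. hermitian V \<longrightarrow>
        ((\<lambda>\<epsilon>. F (X + \<epsilon> *\<^sub>R V)) has_real_derivative frob_inner G V) (at 0))"

definition gradient :: "(complex^'n^'n \<Rightarrow> real) \<Rightarrow> complex^'n^'n \<Rightarrow> complex^'n^'n" where
  "gradient F X = (THE G. has_gradient F X G)"

definition TBD :: "(complex^'n^'n \<Rightarrow> real) \<Rightarrow> complex^'n^'n \<Rightarrow> complex^'n^'n \<Rightarrow> real" where
  "TBD F X Y = (F X - F Y - frob_inner (gradient F Y) (X - Y))
                 / sqrt (1 + (frob_norm (gradient F Y))\<^sup>2)"

lemma frob_inner_eq_inner: "frob_inner X Y = X \<bullet> Y"
proof -
  have "frob_inner X Y = (\<Sum>i\<in>UNIV. \<Sum>k\<in>UNIV. X $ k $ i \<bullet> Y $ k $ i)"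
    by (simp add: frob_inner_def trace_def matrix_matrix_mult_def conj_transpose_def inner_complex_def)
  also have "\<dots> = X \<bullet> Y"
    by (subst sum.swap) (simp add: inner_vec_def)
  finally show ?thesis .
qed

lemma frob_norm_eq_norm: "frob_norm X = norm X"
  by (simp add: frob_norm_def frob_inner_eq_inner norm_eq_sqrt_inner)

lemma of_real_frob_inner:
  assumes "hermitian X" "hermitian Y"
  shows "complex_of_real (frob_inner X Y) = trace (conj_transpose X ** Y)"
proof -
  have X: "cnj (X $ i $ j) = X $ j $ i" and Y: "cnj (Y $ i $ j) = Y $ j $ i" for i j
    using assms unfolding hermitian_def conj_transpose_def by (metis vec_lambda_beta)+
  have "cnj (trace (conj_transpose X ** Y)) = (\<Sum>i\<in>UNIV. \<Sum>k\<in>UNIV. X $ k $ i * Y $ i $ k)"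
    by (simp add: trace_def matrix_matrix_mult_def conj_transpose_def Y)
  also have "\<dots> = (\<Sum>i\<in>UNIV. \<Sum>k\<in>UNIV. X $ i $ k * Y $ k $ i)"
    by (rule sum.swap)
  also have "\<dots> = trace (conj_transpose X ** Y)"
    by (simp add: trace_def matrix_matrix_mult_def conj_transpose_def X)
  finally show ?thesis
    by (simp add: frob_inner_def complex_eq_iff)
qed

lemma has_gradient_unique:
  assumes "has_gradient F X G" "has_gradient F X H"
  shows "G = H"
proof -
  have herm: "hermitian (G - H)"
    using assms by (simp add: has_gradient_def hermitian_def conj_transpose_def vec_eq_iff)
  have "G \<bullet> (G - H) = H \<bullet> (G - H)"
    using assms herm DERIV_unique unfolding has_gradient_def frob_inner_eq_inner by blast
  then have "(G - H) \<bullet> (G - H) = 0"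
    by (simp add: inner_diff_left)
  then show ?thesis by simp
qed

end

theory Submission
  imports Defs
begin

text \<open>Since \<^const>\<open>HPD\<close> is open in the Hermitian matrices, the objective has a local minimum at the
  TBD mean along every Hermitian line through it, so its directional derivatives vanish there. With
  weights \<open>w\<^sub>i = 1 / sqrt (1 + \<parallel>\<nabla>F X\<^sub>i\<parallel>\<^sup>2)\<close> this says that
  \<open>(\<Sum>w\<^sub>i) \<nabla>F X - \<Sum>w\<^sub>i \<nabla>F X\<^sub>i\<close> is orthogonal to all Hermitian
  matrices; being Hermitian itself, it is zero.\<close>

lemma conj_transpose_conj_transpose [simp]: "conj_transpose (conj_transpose A) = A"
  by (simp add: conj_transpose_def vec_eq_iff)

lemma linear_conj_transpose: "linear conj_transpose"
  by (rule linearI) (simp_all add: conj_transpose_def vec_eq_iff)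

lemma hermitian_scaleR: "hermitian A \<Longrightarrow> hermitian (c *\<^sub>R A)"
  by (simp add: hermitian_def linear_cmul[OF linear_conj_transpose])

lemma hermitian_add: "hermitian A \<Longrightarrow> hermitian B \<Longrightarrow> hermitian (A + B)"
  by (simp add: hermitian_def linear_add[OF linear_conj_transpose])

lemma hermitian_diff: "hermitian A \<Longrightarrow> hermitian B \<Longrightarrow> hermitian (A - B)"
  by (simp add: hermitian_def linear_diff[OF linear_conj_transpose])

lemma hermitian_sum: "(\<And>i. i \<in> I \<Longrightarrow> hermitian (A i)) \<Longrightarrow> hermitian (\<Sum>i\<in>I. A i)"
  by (simp add: hermitian_def linear_sum[OF linear_conj_transpose])

text \<open>The real inner product on the complex numbers is unchanged when both factors are
  conjugated, and transposing only reorders the double sum. So \<open>conj_transpose\<close> is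
  self-adjoint, and a matrix and its Hermitian part pair equally with Hermitian matrices.\<close>

lemma inner_conj_transpose:
  fixes A :: "complex^'n^'m"
  shows "conj_transpose A \<bullet> B = A \<bullet> conj_transpose B"
proof -
  have "conj_transpose A \<bullet> B = (\<Sum>i\<in>UNIV. \<Sum>j\<in>UNIV. A $ j $ i \<bullet> cnj (B $ i $ j))"
    by (simp add: inner_vec_def conj_transpose_def inner_complex_def)
  also have "\<dots> = A \<bullet> conj_transpose B"
    by (subst sum.swap) (simp add: inner_vec_def conj_transpose_def)
  finally show ?thesis .
qed

lemma HPD_iff: "A \<in> HPD \<longleftrightarrow> hermitian A \<and> (\<forall>x. x \<noteq> 0 \<longrightarrow> 0 < x \<bullet> (A *v x))"
proof -
  have "Re (\<Sum>i\<in>UNIV. cnj (x $ i) * (A *v x) $ i) = x \<bullet> (A *v x)" for x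
    by (simp add: inner_vec_def inner_complex_def)
  then show ?thesis by (simp add: HPD_def)
qed

lemma bounded_linear_matrix_vector_mul_complex:
  fixes A :: "complex^'n^'m"
  shows "bounded_linear ((*v) A)"
proof -
  have "linear ((*v) A)"
    by (rule linearI)
      (simp_all add: matrix_vector_mult_def vec_eq_iff sum.distrib distrib_left scaleR_sum_right)
  then show ?thesis by (rule linear_conv_bounded_linear[THEN iffD1])
qed

text \<open>The quadratic form is continuous, so it attains a minimum on the compact unit sphere;
  this positive minimum serves as \<open>c\<close>, and homogeneity of degree two extends the bound
  to all vectors.\<close>

lemma HPD_coercive:
  fixes A :: "complex^'n^'n"
  assumes "A \<in> HPD"
  obtains c where "0 < c" "\<And>x. c * (norm x)\<^sup>2 \<le> x \<bullet> (A *v x)"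
proof -
  interpret A: bounded_linear "(*v) A" by (rule bounded_linear_matrix_vector_mul_complex)
  let ?S = "sphere (0 :: complex^'n) 1"
  have "continuous_on ?S (\<lambda>x. x \<bullet> (A *v x))"
    by (intro continuous_intros A.continuous_on)
  moreover have "compact ?S" "?S \<noteq> {}" by auto
  ultimately obtain u where u: "u \<in> ?S" "\<And>x. x \<in> ?S \<Longrightarrow> u \<bullet> (A *v u) \<le> x \<bullet> (A *v x)"
    using continuous_attains_inf by metis
  show ?thesis
  proof
    have "u \<noteq> 0" using u(1) by auto
    then show "0 < u \<bullet> (A *v u)" using assms by (simp add: HPD_iff)
    show "u \<bullet> (A *v u) * (norm x)\<^sup>2 \<le> x \<bullet> (A *v x)" for x
    proof (cases "x = 0")
      case False
      then have "u \<bullet> (A *v u) \<le> (x /\<^sub>R norm x) \<bullet> (A *v (x /\<^sub>R norm x))"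
        by (intro u(2)) simp
      also have "\<dots> = (x \<bullet> (A *v x)) / (norm x)\<^sup>2"
        by (simp only: A.scaleR inner_scaleR_left inner_scaleR_right)
          (simp add: power2_eq_square field_simps)
      finally show ?thesis using False by (simp add: field_simps)
    qed simp
  qed
qed

text \<open>This is openness of \<open>HPD\<close> within the Hermitian matrices, along one line.
  Moving by \<open>\<epsilon>\<close> changes the form by at most
  \<open>\<bar>\<epsilon>\<bar> * K\<close> times the squared norm, which the coercivity constant
  \<open>c\<close> dominates for small \<open>\<epsilon>\<close>.\<close>

lemma eventually_line_in_HPD:
  fixes X V :: "complex^'n^'n"
  assumes "X \<in> HPD" "hermitian V"
  shows "\<forall>\<^sub>F \<epsilon> in nhds 0. X + \<epsilon> *\<^sub>R V \<in> HPD"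
proof -
  obtain c where c: "0 < c" "\<And>x. c * (norm x)\<^sup>2 \<le> x \<bullet> (X *v x)"
    using HPD_coercive[OF assms(1)] by metis
  obtain K where K: "\<And>x. norm (V *v x) \<le> norm x * K"
    using bounded_linear.bounded[OF bounded_linear_matrix_vector_mul_complex[of V]] by metis
  have "((\<lambda>\<epsilon>. \<bar>\<epsilon>\<bar> * K) \<longlongrightarrow> \<bar>0\<bar> * K) (nhds 0)"
    by (intro tendsto_intros filterlim_ident)
  then have "\<forall>\<^sub>F \<epsilon> in nhds 0. \<bar>\<epsilon>\<bar> * K < c"
    using c(1) by (intro order_tendstoD(2)) auto
  then show ?thesis
  proof eventually_elim
    case (elim \<epsilon>)
    have "0 < x \<bullet> ((X + \<epsilon> *\<^sub>R V) *v x)" if "x \<noteq> 0" for x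
    proof -
      have "\<bar>x \<bullet> (V *v x)\<bar> \<le> norm x * (norm x * K)"
        using Cauchy_Schwarz_ineq2[of x "V *v x"] mult_left_mono[OF K, of "norm x" x] by simp
      then have "\<bar>\<epsilon> * (x \<bullet> (V *v x))\<bar> \<le> \<bar>\<epsilon>\<bar> * (K * (norm x)\<^sup>2)"
        unfolding abs_mult by (intro mult_left_mono) (simp_all add: power2_eq_square mult_ac)
      also have "\<dots> < c * (norm x)\<^sup>2"
        using elim that by (simp add: mult.assoc[symmetric])
      also have "\<dots> \<le> x \<bullet> (X *v x)" by (rule c(2))
      also have "(X + \<epsilon> *\<^sub>R V) *v x = X *v x + \<epsilon> *\<^sub>R (V *v x)"
        by (simp add: matrix_vector_mult_def vec_eq_iff sum.distrib distrib_right scaleR_sum_right)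
      ultimately show ?thesis by (simp add: inner_add_right)
    qed
    moreover have "hermitian (X + \<epsilon> *\<^sub>R V)"
      using assms by (simp add: HPD_iff hermitian_add hermitian_scaleR)
    ultimately show ?case by (simp add: HPD_iff)
  qed
qed

text \<open>\<open>HPD\<close> has empty interior among all complex matrices, so \<open>F\<close> is
  differentiable only within it. The chain rule still gives a two-sided derivative, because an open
  interval's worth of parameters around 0 is mapped into \<open>HPD\<close>.\<close>

lemma has_derivative_within_HPD_line:
  assumes F': "(F has_derivative F') (at X within HPD)" and X: "X \<in> HPD" and V: "hermitian V"
  shows "((\<lambda>\<epsilon>. F (X + \<epsilon> *\<^sub>R V)) has_real_derivative F' V) (at 0)"
proof -
  obtain S where S: "open S" "0 \<in> S" "\<And>\<epsilon>. \<epsilon> \<in> S \<Longrightarrow> X + \<epsilon> *\<^sub>R V \<in> HPD"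
    using eventually_line_in_HPD[OF X V] unfolding eventually_nhds by blast
  interpret F': bounded_linear F' using F' by (rule has_derivative_bounded_linear)
  have "((\<lambda>\<epsilon>. X + \<epsilon> *\<^sub>R V) has_derivative (\<lambda>h. h *\<^sub>R V)) (at 0 within S)"
    by (auto intro!: derivative_eq_intros)
  moreover have "(F has_derivative F') (at (X + 0 *\<^sub>R V) within (\<lambda>\<epsilon>. X + \<epsilon> *\<^sub>R V) ` S)"
    using S(3) by (auto intro: has_derivative_subset[OF F'])
  ultimately have "((\<lambda>\<epsilon>. F (X + \<epsilon> *\<^sub>R V)) has_derivative (\<lambda>h. F' (h *\<^sub>R V))) (at 0 within S)"
    by (rule has_derivative_in_compose)
  then show ?thesis
    unfolding has_field_derivative_def at_within_open[OF S(2,1)] F'.scaleR real_scaleR_def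
    by (simp only: mult_commute_abs)
qed

text \<open>Shows that the definite description in \<open>gradient\<close> denotes: existence comes
  from representing the derivative by an inner product, uniqueness from
  \<open>has_gradient_unique\<close>.\<close>

lemma has_gradient_gradient:
  fixes F :: "complex^'n^'n \<Rightarrow> real"
  assumes "F differentiable_on HPD" "X \<in> HPD"
  shows "has_gradient F X (gradient F X)"
proof -
  obtain F' where F': "(F has_derivative F') (at X within HPD)"
    using assms by (auto simp: differentiable_on_def differentiable_def)
  have lin: "linear F'" using F' by (simp add: has_derivative_linear)
  \<comment> \<open>The Riesz representative of the functional \<open>F'\<close>, since
    \<open>F' V\<close> is the inner product of \<open>F' V\<close> with 1 in the reals.\<close>
  define W where "W = adjoint F' 1"
  have W: "F' V = W \<bullet> V" for V
    using adjoint_works[OF lin, of V 1] by (simp add: W_def inner_commute)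
  \<comment> \<open>\<open>W\<close> represents the derivative but need not be Hermitian; its Hermitian part agrees with it on
    Hermitian directions.\<close>
  define G where "G = (1/2) *\<^sub>R (W + conj_transpose W)"
  have "hermitian G"
    by (simp add: G_def hermitian_def linear_cmul[OF linear_conj_transpose]
        linear_add[OF linear_conj_transpose] add.commute)
  moreover have "G \<bullet> V = F' V" if "hermitian V" for V
    using that by (simp add: G_def W inner_add_left inner_conj_transpose hermitian_def)
  ultimately have "has_gradient F X G"
    using has_derivative_within_HPD_line[OF F' assms(2)]
    by (simp add: has_gradient_def frob_inner_eq_inner)
  then show ?thesis
    unfolding gradient_def by (rule theI) (rule has_gradient_unique[OF _ \<open>has_gradient F X G\<close>])
qed

text \<open>In its first argument \<open>TBD\<close> is \<open>F\<close> minus an affine function,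
  divided by a constant that depends on \<open>Y\<close> alone.\<close>

lemma TBD_has_derivative_line:
  assumes "has_gradient F X G" "hermitian V"
  shows "((\<lambda>\<epsilon>. TBD F (X + \<epsilon> *\<^sub>R V) Y) has_real_derivative
    ((G - gradient F Y) \<bullet> V) / sqrt (1 + (frob_norm (gradient F Y))\<^sup>2)) (at 0)"
proof -
  have F: "((\<lambda>\<epsilon>. F (X + \<epsilon> *\<^sub>R V)) has_real_derivative G \<bullet> V) (at 0)"
    using assms by (simp add: has_gradient_def frob_inner_eq_inner)
  have "((\<lambda>\<epsilon>. F (X + \<epsilon> *\<^sub>R V) - F Y
          - (gradient F Y \<bullet> (X - Y) + \<epsilon> * (gradient F Y \<bullet> V))) has_real_derivative
      (G - gradient F Y) \<bullet> V) (at 0)"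
    by (auto intro!: derivative_eq_intros F simp: inner_diff_left)
  from DERIV_cdivide[OF this] show ?thesis
    by (simp add: TBD_def frob_inner_eq_inner inner_diff_right inner_add_right algebra_simps)
qed

theorem proposition6:
  fixes F :: "complex^'n^'n \<Rightarrow> real"
    and Xs :: "nat \<Rightarrow> complex^'n^'n"
    and Xbar :: "complex^'n^'n"
    and m :: nat
  assumes "strictly_convex_on HPD F"
    and "F differentiable_on HPD"
    and "m \<ge> 1"
    and "\<And>i. i \<in> {1..m} \<Longrightarrow> Xs i \<in> HPD"
    and "is_arg_min (\<lambda>X. (1 / real m) * (\<Sum>i=1..m. TBD F X (Xs i))) (\<lambda>X. X \<in> HPD) Xbar"
  shows "gradient F Xbar =
    (\<Sum>i=1..m. gradient F (Xs i) /\<^sub>R sqrt (1 + (frob_norm (gradient F (Xs i)))\<^sup>2))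
      /\<^sub>R (\<Sum>j=1..m. 1 / sqrt (1 + (frob_norm (gradient F (Xs j)))\<^sup>2))"
proof -
  define G where "G = gradient F Xbar"
  define s where "s i = sqrt (1 + (frob_norm (gradient F (Xs i)))\<^sup>2)" for i
  define w where "w = (\<Sum>j=1..m. 1 / s j)"
  define A where "A = (\<Sum>i=1..m. gradient F (Xs i) /\<^sub>R s i)"
  \<comment> \<open>\<open>V\<close> is the gradient at \<open>Xbar\<close> of the sum of the
    divergences. Testing this single direction suffices: the derivative along it is
    \<open>V \<bullet> V\<close>, whose vanishing forces \<open>V = 0\<close>.\<close>
  define V where "V = w *\<^sub>R G - A"
  have Xbar: "Xbar \<in> HPD" using assms(5) by (simp add: is_arg_min_def)
  have G: "has_gradient F Xbar G"
    unfolding G_def using assms(2) Xbar by (rule has_gradient_gradient)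
  have "hermitian (gradient F (Xs i))" if "i \<in> {1..m}" for i
    using has_gradient_gradient[OF assms(2) assms(4)[OF that]] by (simp add: has_gradient_def)
  then have V: "hermitian V"
    using G unfolding V_def A_def
    by (intro hermitian_diff hermitian_scaleR hermitian_sum) (auto simp: has_gradient_def)
  have w: "w > 0"
    unfolding w_def s_def using assms(3)
    by (intro sum_pos) (auto intro!: divide_pos_pos add_pos_nonneg)
  \<comment> \<open>The factor \<open>1 / real m\<close> is left out here; being positive, it does
    not affect which points are minima.\<close>
  let ?f = "\<lambda>\<epsilon>. (\<Sum>i=1..m. TBD F (Xbar + \<epsilon> *\<^sub>R V) (Xs i))"
  have "(?f has_real_derivative (\<Sum>i=1..m. ((G - gradient F (Xs i)) \<bullet> V) / s i)) (at 0)"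
    unfolding s_def by (intro DERIV_sum TBD_has_derivative_line G V)
  moreover have "(\<Sum>i=1..m. ((G - gradient F (Xs i)) \<bullet> V) / s i) = V \<bullet> V"
  proof -
    have "(\<Sum>i=1..m. ((G - gradient F (Xs i)) \<bullet> V) / s i)
        = (\<Sum>i=1..m. (1 / s i) *\<^sub>R G - gradient F (Xs i) /\<^sub>R s i) \<bullet> V"
      by (simp add: inner_sum_left inner_diff_left right_diff_distrib divide_inverse mult.commute)
    also have "(\<Sum>i=1..m. (1 / s i) *\<^sub>R G - gradient F (Xs i) /\<^sub>R s i) = V"
      by (simp add: V_def A_def w_def sum_subtractf scaleR_sum_left)
    finally show ?thesis .
  qed
  ultimately have deriv: "(?f has_real_derivative V \<bullet> V) (at 0)" by simp
  obtain d where d: "d > 0" "\<And>\<epsilon>. \<bar>\<epsilon>\<bar> < d \<Longrightarrow> Xbar + \<epsilon> *\<^sub>R V \<in> HPD"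
    using eventually_line_in_HPD[OF Xbar V] unfolding eventually_nhds_metric
    by (auto simp: dist_real_def)
  have "?f 0 \<le> ?f \<epsilon>" if "\<bar>0 - \<epsilon>\<bar> < d" for \<epsilon>
  proof -
    have "Xbar + \<epsilon> *\<^sub>R V \<in> HPD" using d(2) that by simp
    with assms(5) have "\<not> (1 / real m) * ?f \<epsilon> < (1 / real m) * ?f 0"
      by (simp add: is_arg_min_def)
    then show ?thesis using assms(3) by (simp add: divide_less_cancel not_less)
  qed
  then have "V \<bullet> V = 0" using DERIV_local_min[OF deriv d(1)] by blast
  then have "w *\<^sub>R G = A" by (simp add: V_def)
  then have "G = A /\<^sub>R w" using w by auto
  then show ?thesis by (simp add: G_def A_def w_def s_def)
qed

end
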